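(* Let $C=(V,E)$ be an undirected cycle, let $s,t\in V$ with $s\neq t$, and let $r>0$. Let $P$ be the set of $s$–$t$ paths in $C$. Let $f,f'$ be two feasible flows for the single-commodity instance $(C,(s,t),r)$, i.e. functions $f,f':P\to\mathbb{R}_{\ge 0}$ with $\sum_{p\in P}f(p)=\sum_{p\in P}f'(p)=r$. For an edge $e\in E$ put $f(e)=\sum_{p\in P,\ e\in p}f(p)$ and $f'(e)=\sum_{p\in P,\ e\in p}f'(p)$. Then there exists a path $p\in P$ with $f(p)>0$ such that $f(e)\ge f'(e)$ for every edge $e\in p$.
   Context: A path from $s$ to $t$ in the cycle $C$ means a simple path; since $C$ is a cycle and $s\ne t$, there are exactly two $s$–$t$ paths, and they are edge-disjoint. "$e\in p$" means the edge $e$ lies on the path $p$. *)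

theory Defs
  imports Complex_Main
begin

text \<open>An undirected simple graph is given by its vertex set and its set of edges, an edge being
  the two-element set of its endpoints.\<close>

definition undirected_cycle :: "'a set \<Rightarrow> 'a set set \<Rightarrow> bool" where
  "undirected_cycle V E \<longleftrightarrow>
     (\<exists>vs. distinct vs \<and> length vs \<ge> 3 \<and> V = set vs \<and>
       E = {{vs ! i, vs ! (Suc i mod length vs)} | i. i < length vs})"

definition path_edges :: "'a list \<Rightarrow> 'a set set" where
  "path_edges p = {{p ! i, p ! Suc i} | i. Suc i < length p}"

text \<open>A simple path from \<open>s\<close> to \<open>t\<close> is represented by its vertex sequence, which in a simple graph
  determines the path uniquely.\<close>

definition st_paths :: "'a set \<Rightarrow> 'a set set \<Rightarrow> 'a \<Rightarrow> 'a \<Rightarrow> 'a list set" where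
  "st_paths V E s t =
     {p. p \<noteq> [] \<and> hd p = s \<and> last p = t \<and> distinct p \<and> set p \<subseteq> V \<and> path_edges p \<subseteq> E}"

text \<open>A flow is a total function on vertex sequences of which only the values on the
  \<open>s\<close>-\<open>t\<close> paths are relevant.\<close>

definition feasible_flow ::
  "'a set \<Rightarrow> 'a set set \<Rightarrow> 'a \<Rightarrow> 'a \<Rightarrow> real \<Rightarrow> ('a list \<Rightarrow> real) \<Rightarrow> bool" where
  "feasible_flow V E s t r f \<longleftrightarrow>
     (\<forall>p \<in> st_paths V E s t. f p \<ge> 0) \<and> (\<Sum>p \<in> st_paths V E s t. f p) = r"

definition edge_flow ::
  "'a set \<Rightarrow> 'a set set \<Rightarrow> 'a \<Rightarrow> 'a \<Rightarrow> ('a list \<Rightarrow> real) \<Rightarrow> 'a set \<Rightarrow> real" where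
  "edge_flow V E s t f e = (\<Sum>p \<in> {p \<in> st_paths V E s t. e \<in> path_edges p}. f p)"

text \<open>The path set of a cycle is finite, so the sums above are genuine finite sums.\<close>

lemma finite_st_paths:
  assumes "undirected_cycle V E"
  shows "finite (st_paths V E s t)"
proof (rule finite_subset)
  have fin: "finite V"
    using assms by (auto simp: undirected_cycle_def)
  show "st_paths V E s t \<subseteq> {p. set p \<subseteq> V \<and> length p \<le> card V}"
    using fin by (auto simp: st_paths_def distinct_card[symmetric] intro: card_mono)
  show "finite {p. set p \<subseteq> V \<and> length p \<le> card V}"
    using fin by (rule finite_lists_length_le)
qed

end

(* A cycle has maximum degree two, so two simple walks that traverse a common edge in the same
   direction coincide for as long as both last.  Hence distinct s-t paths are edge-disjoint, and on
   every edge of a path p the flow through the edge is f(p).  If the claim failed, every path p with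
   f(p) > 0 would satisfy f(p) < f'(p), so the total of f would be smaller than that of f'. *)

theory Submission
  imports Defs "HOL-Library.Sublist"
begin

text \<open>The only candidates for a neighbour of \<open>vs ! k\<close> are its cyclic successor
  and its cyclic predecessor, so among three neighbours two coincide.\<close>

lemma undirected_cycle_degree_le_2:
  assumes "undirected_cycle V E" and "{b, x} \<in> E" and "{b, y} \<in> E" and "{b, z} \<in> E"
  shows "x = y \<or> x = z \<or> y = z"
proof -
  obtain vs where vs: "distinct vs" "length vs \<ge> 3"
    and E: "E = {{vs ! i, vs ! (Suc i mod length vs)} | i. i < length vs}"
    using assms(1) by (auto simp: undirected_cycle_def)
  let ?n = "length vs"
  obtain k where k: "k < ?n" "b = vs ! k"
  proof -
    obtain i where "i < ?n" "{b, x} = {vs ! i, vs ! (Suc i mod ?n)}"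
      using assms(2) E by auto
    moreover have "Suc i mod ?n < ?n"
      using vs(2) by (intro mod_less_divisor) linarith
    ultimately show ?thesis
      using that by (auto simp: doubleton_eq_iff)
  qed
  \<comment> \<open>The predecessor is described by the equation \<open>Suc i mod ?n = k\<close>
    instead of a subtraction, so the wrap-around at \<open>k = 0\<close> needs no separate treatment
    here.\<close>
  have neighbour: "c = vs ! (Suc k mod ?n) \<or> (\<exists>i<?n. c = vs ! i \<and> Suc i mod ?n = k)"
    if c: "{b, c} \<in> E" for c
  proof -
    obtain i where i: "i < ?n" "{b, c} = {vs ! i, vs ! (Suc i mod ?n)}"
      using c E by auto
    have "Suc i mod ?n < ?n"
      using vs(2) by (intro mod_less_divisor) linarith
    then show ?thesis
      using i k vs(1) by (auto simp: doubleton_eq_iff nth_eq_iff_index_eq)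
  qed
  have pred_unique: "i = j" if "i < ?n" "j < ?n" "Suc i mod ?n = k" "Suc j mod ?n = k" for i j
    using that by (auto simp: mod_Suc split: if_splits)
  show ?thesis
    using neighbour[OF assms(2)] neighbour[OF assms(3)] neighbour[OF assms(4)] pred_unique
    by metis
qed

lemma path_edges_subset_iff_successively:
  "path_edges p \<subseteq> E \<longleftrightarrow> successively (\<lambda>x y. {x, y} \<in> E) p"
  by (auto simp: path_edges_def successively_conv_nth)

lemma path_edgesE:
  assumes "e \<in> path_edges p"
  obtains us u v ws where "p = us @ u # v # ws" "e = {u, v}"
proof -
  obtain i where i: "Suc i < length p" "e = {p ! i, p ! Suc i}"
    using assms by (auto simp: path_edges_def)
  then have "p = take i p @ p ! i # p ! Suc i # drop (Suc (Suc i)) p"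
    by (metis Cons_nth_drop_Suc Suc_lessD append_take_drop_id)
  then show ?thesis
    using that i(2) by blast
qed

text \<open>Having reached \<open>b\<close> from \<open>a\<close>, a simple walk cannot return to
  \<open>a\<close>, so the degree bound leaves only one vertex to go on to. The induction shifts the
  common edge from \<open>a\<close>, \<open>b\<close> to \<open>b\<close>, \<open>x\<close>.\<close>

lemma prefix_comparable_of_common_first_edge:
  assumes deg: "\<And>b x y z. {b, x} \<in> E \<Longrightarrow> {b, y} \<in> E \<Longrightarrow> {b, z} \<in> E \<Longrightarrow> x = y \<or> x = z \<or> y = z"
    and "distinct (a # b # xs)" "successively (\<lambda>x y. {x, y} \<in> E) (a # b # xs)"
    and "distinct (a # b # ys)" "successively (\<lambda>x y. {x, y} \<in> E) (a # b # ys)"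
  shows "prefix xs ys \<or> prefix ys xs"
  using assms(2-)
proof (induction xs arbitrary: a b ys)
  case Nil
  then show ?case by simp
next
  case (Cons x xs)
  show ?case
  proof (cases ys)
    case Nil
    then show ?thesis by simp
  next
    case (Cons y ys')
    have "x = y"
      using deg[of b a x y] Cons.prems Cons by (auto simp: insert_commute)
    moreover from this have "prefix xs ys' \<or> prefix ys' xs"
      using Cons.prems Cons by (intro Cons.IH[of b x ys']) auto
    ultimately show ?thesis
      using Cons by simp
  qed
qed

text \<open>A proper extension of \<open>xs\<close> with the same last element would contain that
  element twice.\<close>

lemma prefix_same_last_eq:
  assumes "prefix xs ys" "distinct ys" "last xs = last ys" "xs \<noteq> []"
  shows "xs = ys"
proof -
  obtain zs where "ys = xs @ zs"
    using assms(1) by (auto simp: prefix_def)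
  then show ?thesis
    using assms(2-) by (cases "zs = []") (auto simp: disjoint_iff, metis last_in_set)
qed

text \<open>Both paths are cut at the common edge and followed outwards from it in both directions.
  If they traverse the edge in the same direction, both halves agree; opposite directions force a
  repeated vertex.\<close>

lemma st_paths_edge_disjoint:
  assumes "undirected_cycle V E" and p: "p \<in> st_paths V E s t" and q: "q \<in> st_paths V E s t"
    and "e \<in> path_edges p" "e \<in> path_edges q"
  shows "p = q"
proof -
  let ?R = "\<lambda>x y. {x, y} \<in> E"
  have comparable: "prefix xs ys \<or> prefix ys xs"
    if "distinct (a # b # xs)" "successively ?R (a # b # xs)"
      "distinct (a # b # ys)" "successively ?R (a # b # ys)" for a b xs ys
    by (rule prefix_comparable_of_common_first_edge[OF _ that])
      (rule undirected_cycle_degree_le_2[OF assms(1)])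
  have p': "distinct p" "successively ?R p" "hd p = s" "last p = t"
    and q': "distinct q" "successively ?R q" "hd q = s" "last q = t"
    using p q by (auto simp: st_paths_def path_edges_subset_iff_successively)
  obtain us u v ws where p_eq: "p = us @ u # v # ws" and e: "e = {u, v}"
    using assms(4) by (rule path_edgesE)
  obtain us' u' v' ws' where q_eq: "q = us' @ u' # v' # ws'" and e': "e = {u', v'}"
    using assms(5) by (rule path_edgesE)
  have p_fwd: "distinct (u # v # ws)" "successively ?R (u # v # ws)"
    and q_fwd: "distinct (u' # v' # ws')" "successively ?R (u' # v' # ws')"
    using p' q' p_eq q_eq by (auto simp: successively_append_iff)
  \<comment> \<open>Edges are unordered, so the initial segments read backwards are again walks, now
    starting with the common edge and leading to \<open>s\<close>.\<close>
  have p_bwd: "distinct (v # u # rev us)" "successively ?R (v # u # rev us)"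
    and q_bwd: "distinct (v' # u' # rev us')" "successively ?R (v' # u' # rev us')"
    using p' q' p_eq q_eq
    by (auto simp: successively_append_iff successively_Cons successively_rev hd_rev insert_commute)
  \<comment> \<open>The endpoints of the edge stay in front because \<open>ws\<close> or
    \<open>us\<close> is empty when the edge is the last or the first of its path.\<close>
  have last_p: "last (v # ws) = t" and last_q: "last (v' # ws') = t"
    and first_p: "last (u # rev us) = s" and first_q: "last (u' # rev us') = s"
    using p'(3,4) q'(3,4) p_eq q_eq by (auto simp: last_rev hd_append)
  show ?thesis
  proof (cases "u = u'")
    case True
    then have v: "v = v'"
      using e e' p_fwd by (auto simp: doubleton_eq_iff)
    have "prefix (v # ws) (v # ws') \<or> prefix (v # ws') (v # ws)"
      using comparable[OF p_fwd] q_fwd True v by simp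
    then have "v # ws = v # ws'"
      using prefix_same_last_eq[of "v # ws" "v # ws'"] prefix_same_last_eq[of "v # ws'" "v # ws"]
        p_fwd(1) q_fwd(1) last_p last_q v by force
    moreover have "prefix (u # rev us) (u # rev us') \<or> prefix (u # rev us') (u # rev us)"
      using comparable[OF p_bwd] q_bwd True v by simp
    then have "u # rev us = u # rev us'"
      using prefix_same_last_eq[of "u # rev us" "u # rev us'"]
        prefix_same_last_eq[of "u # rev us'" "u # rev us"]
        p_bwd(1) q_bwd(1) first_p first_q True by force
    ultimately show ?thesis
      using True v p_eq q_eq by simp
  next
    case False
    (* The backward part of q runs along the forward part of p, so p revisits s or q meets t early. *)
    then have uv: "u' = v" "v' = u"
      using e e' by (auto simp: doubleton_eq_iff)
    have "prefix ws (rev us') \<or> prefix (rev us') ws"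
      using comparable[OF p_fwd] q_bwd uv by simp
    then consider "set (v # ws) \<subseteq> set (v # rev us')" | "set (v # rev us') \<subseteq> set (v # ws)"
      using set_mono_prefix by fastforce
    then show ?thesis
    proof cases
      case 1
      then have "t \<in> set (v # rev us')"
        using last_p last_in_set[of "v # ws"] by auto
      moreover have "t \<in> set (u # ws')"
        using last_q last_in_set[of "u # ws'"] uv by auto
      ultimately show ?thesis
        using q'(1) q_eq uv by auto
    next
      case 2
      then have "s \<in> set (v # ws)"
        using first_q last_in_set[of "v # rev us'"] uv by auto
      moreover have "s \<in> set (u # rev us)"
        using first_p last_in_set[of "u # rev us"] by auto
      ultimately show ?thesis
        using p'(1) p_eq by auto
    qed
  qed
qed

text \<open>By edge-disjointness the sum over paths through \<open>e\<close> has the single term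
  \<open>p\<close>; this reduces comparing edge flows to comparing path values.\<close>

lemma edge_flow_eq_path_flow:
  assumes "undirected_cycle V E" and "p \<in> st_paths V E s t" and "e \<in> path_edges p"
  shows "edge_flow V E s t f e = f p"
proof -
  have "{q \<in> st_paths V E s t. e \<in> path_edges q} = {p}"
    using assms st_paths_edge_disjoint[OF assms(1)] by auto
  then show ?thesis
    by (simp add: edge_flow_def)
qed

theorem theorem2p1:
  fixes V :: "'a set" and E :: "'a set set" and s t :: 'a and r :: real
    and f f' :: "'a list \<Rightarrow> real"
  assumes "undirected_cycle V E"
    and "s \<in> V" and "t \<in> V" and "s \<noteq> t"
    and "r > 0"
    and "feasible_flow V E s t r f"
    and "feasible_flow V E s t r f'"
  shows "\<exists>p \<in> st_paths V E s t. f p > 0 \<and>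
           (\<forall>e \<in> path_edges p. edge_flow V E s t f e \<ge> edge_flow V E s t f' e)"
proof -
  let ?P = "st_paths V E s t"
  have sums: "sum f ?P = r" "sum f' ?P = r"
    and nonneg: "\<forall>p\<in>?P. f p \<ge> 0" "\<forall>p\<in>?P. f' p \<ge> 0"
    using assms(6,7) by (auto simp: feasible_flow_def)
  have "\<exists>p\<in>?P. f p > 0 \<and> f p \<ge> f' p"
  proof (rule ccontr)
    assume "\<not> ?thesis"
    then have less: "f p < f' p" if "p \<in> ?P" "f p > 0" for p
      using that by force
    \<comment> \<open>Since \<open>r > 0\<close>, some path carries flow; it supplies the strict
      inequality between the sums.\<close>
    obtain p where "p \<in> ?P" "f p > 0"
      using sums(1) assms(5) sum_nonpos[of ?P f] by force
    \<comment> \<open>On a path with \<open>f q = 0\<close> the bound comes from the nonnegativity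
      of \<open>f'\<close>.\<close>
    moreover have "f q \<le> f' q" if "q \<in> ?P" for q
      using less[OF that] nonneg that by fastforce
    ultimately have "sum f ?P < sum f' ?P"
      using less finite_st_paths[OF assms(1)] by (intro sum_strict_mono_ex1) auto
    with sums show False
      by simp
  qed
  then show ?thesis
    using edge_flow_eq_path_flow[OF assms(1)] by fastforce
qed

end
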